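(* Let $a>0$, let $(B,\mu)$ be a probability space, let $R:B\to B$ be an invertible map preserving $\mu$, with $\mu$ ergodic, and let $F:B\times[0,a]\to B\times[0,a]$, $F(\vartheta,x)=(R(\vartheta),\psi_\vartheta(x))$, be a monotone equiconcave skew product. Let $\phi_K:B\to[0,a]$ be the function $\phi_K(\vartheta)=\lim_{n\to\infty}\phi_n(\vartheta)$, where $\phi_n(\vartheta)=\pi_2(F^n(R^{-n}(\vartheta),a))$ (a nonincreasing sequence in $n$). If $\phi_K$ is positive $\mu$-almost everywhere, then the graph of $\phi_K$ is an attractor of $F$ with basin of attraction containing the set $Z\times(0,a]$ for some set $Z\subset B$ of full measure $\mu$.
   Context: Here $\psi_\vartheta:[0,a]\to[0,a]$ for $\vartheta\in B$, and $\pi_2(\vartheta,x)=x$. For $\alpha\ge 0$, a continuous real-valued function $f$ on a closed interval is $\alpha$-concave if $x\mapsto f(x)+\alpha x^2$ is concave. The system is a monotone equiconcave skew product if $\psi_\vartheta(0)=0$ and $\psi_\vartheta$ is monotone for each $\vartheta\in B$, and there is a constant $\beta>0$ such that each $\psi_\vartheta$ is $\beta\gamma_\vartheta$-concave, where $\gamma_\vartheta=\sup_{[0,a]}\psi_\vartheta$ (so $\psi_\vartheta\equiv0$ is allowed). The basin of attraction of the graph of $\phi:B\to[0,a]$ is the set of $(\vartheta,x)$ such that $|\pi_2(F^n(\vartheta,x))-\phi(R^n(\vartheta))|\to0$ as $n\to\infty$. The graph of $\phi$ is an attractor if, for $\mu$-almost every $\vartheta\in B$, the point $(\vartheta,\phi(\vartheta))$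 belongs to the basin and the basin intersected with the fiber $\{\vartheta\}\times[0,a]$ contains a neighborhood (in the fiber) of $(\vartheta,\phi(\vartheta))$. *)

theory Defs
  imports "HOL-Probability.Probability"
begin

definition measure_preserving_map :: "'b measure \<Rightarrow> ('b \<Rightarrow> 'b) \<Rightarrow> bool" where
  "measure_preserving_map M R \<longleftrightarrow>
     R \<in> measurable M M \<and>
     (\<forall>A\<in>sets M. emeasure M (R -` A \<inter> space M) = emeasure M A)"

definition ergodic_measure :: "'b measure \<Rightarrow> ('b \<Rightarrow> 'b) \<Rightarrow> bool" where
  "ergodic_measure M R \<longleftrightarrow>
     (\<forall>A\<in>sets M. R -` A \<inter> space M = A \<longrightarrow> emeasure M A = 0 \<or> emeasure M (space M - A) = 0)"

definition alpha_concave_on :: "real set \<Rightarrow> real \<Rightarrow> (real \<Rightarrow> real) \<Rightarrow> bool" where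
  "alpha_concave_on I \<alpha> f \<longleftrightarrow>
     0 \<le> \<alpha> \<and> continuous_on I f \<and> concave_on I (\<lambda>x. f x + \<alpha> * x\<^sup>2)"

definition skew_map :: "('b \<Rightarrow> 'b) \<Rightarrow> ('b \<Rightarrow> real \<Rightarrow> real) \<Rightarrow> 'b \<times> real \<Rightarrow> 'b \<times> real" where
  "skew_map R \<psi> = (\<lambda>(\<theta>, x). (R \<theta>, \<psi> \<theta> x))"

text \<open>The base is a set \<open>B\<close> of points of type \<open>'b\<close> and the fibers are the interval from
  0 to \<open>a\<close>; the behaviour of the total functions \<open>R\<close> and \<open>\<psi>\<close> elsewhere is irrelevant.\<close>

definition monotone_equiconcave ::
    "'b set \<Rightarrow> real \<Rightarrow> ('b \<Rightarrow> real \<Rightarrow> real) \<Rightarrow> bool" where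
  "monotone_equiconcave B a \<psi> \<longleftrightarrow>
     (\<forall>\<theta>\<in>B. \<psi> \<theta> \<in> {0..a} \<rightarrow> {0..a} \<and> \<psi> \<theta> 0 = 0 \<and> mono_on {0..a} (\<psi> \<theta>)) \<and>
     (\<exists>\<beta>>0. \<forall>\<theta>\<in>B. alpha_concave_on {0..a} (\<beta> * (SUP x\<in>{0..a}. \<psi> \<theta> x)) (\<psi> \<theta>))"

definition pullback_approx ::
    "'b set \<Rightarrow> real \<Rightarrow> ('b \<Rightarrow> 'b) \<Rightarrow> ('b \<Rightarrow> real \<Rightarrow> real) \<Rightarrow> nat \<Rightarrow> 'b \<Rightarrow> real" where
  "pullback_approx B a R \<psi> n \<theta> =
     snd ((skew_map R \<psi> ^^ n) ((inv_into B R ^^ n) \<theta>, a))"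

text \<open>The limit exists at every point of \<open>B\<close>, see \<open>pullback_approx_tendsto\<close> below.\<close>

definition pullback_limit ::
    "'b set \<Rightarrow> real \<Rightarrow> ('b \<Rightarrow> 'b) \<Rightarrow> ('b \<Rightarrow> real \<Rightarrow> real) \<Rightarrow> 'b \<Rightarrow> real" where
  "pullback_limit B a R \<psi> \<theta> = lim (\<lambda>n. pullback_approx B a R \<psi> n \<theta>)"

definition graph_basin ::
    "'b set \<Rightarrow> real \<Rightarrow> ('b \<Rightarrow> 'b) \<Rightarrow> ('b \<Rightarrow> real \<Rightarrow> real) \<Rightarrow> ('b \<Rightarrow> real) \<Rightarrow> ('b \<times> real) set" where
  "graph_basin B a R \<psi> \<phi> =
     {(\<theta>, x). \<theta> \<in> B \<and> x \<in> {0..a} \<and>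
        (\<lambda>n. \<bar>snd ((skew_map R \<psi> ^^ n) (\<theta>, x)) - \<phi> ((R ^^ n) \<theta>)\<bar>) \<longlonglongrightarrow> 0}"

text \<open>Neighborhoods in the fiber are taken in the subspace topology of the interval.\<close>

definition graph_attractor ::
    "'b measure \<Rightarrow> real \<Rightarrow> ('b \<Rightarrow> 'b) \<Rightarrow> ('b \<Rightarrow> real \<Rightarrow> real) \<Rightarrow> ('b \<Rightarrow> real) \<Rightarrow> bool" where
  "graph_attractor M a R \<psi> \<phi> \<longleftrightarrow>
     \<phi> \<in> space M \<rightarrow> {0..a} \<and>
     (AE \<theta> in M. (\<theta>, \<phi> \<theta>) \<in> graph_basin (space M) a R \<psi> \<phi> \<and>
        (\<exists>U. openin (top_of_set {0..a}) U \<and> \<phi> \<theta> \<in> U \<and>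
             {\<theta>} \<times> U \<subseteq> graph_basin (space M) a R \<psi> \<phi>))"

lemma skew_map_iterate_mono:
  assumes R: "R ` B \<subseteq> B" and \<psi>: "monotone_equiconcave B a \<psi>" and "\<theta> \<in> B"
    and "x \<in> {0..a}" "y \<in> {0..a}" "x \<le> y"
  shows "snd ((skew_map R \<psi> ^^ n) (\<theta>, x)) \<in> {0..a} \<and> snd ((skew_map R \<psi> ^^ n) (\<theta>, y)) \<in> {0..a} \<and>
    snd ((skew_map R \<psi> ^^ n) (\<theta>, x)) \<le> snd ((skew_map R \<psi> ^^ n) (\<theta>, y))"
  using assms(3-6)
proof (induction n arbitrary: \<theta> x y)
  case (Suc n)
  have F: "\<psi> \<theta> \<in> {0..a} \<rightarrow> {0..a}" "mono_on {0..a} (\<psi> \<theta>)"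
    using \<psi> Suc.prems(1) by (auto simp: monotone_equiconcave_def)
  have "R \<theta> \<in> B" "\<psi> \<theta> x \<in> {0..a}" "\<psi> \<theta> y \<in> {0..a}"
    using R F(1) Suc.prems by blast+
  moreover have "\<psi> \<theta> x \<le> \<psi> \<theta> y"
    using F(2) Suc.prems by (simp add: mono_on_def)
  ultimately show ?case
    using Suc.IH[of "R \<theta>" "\<psi> \<theta> x" "\<psi> \<theta> y"] by (simp add: funpow_Suc_right skew_map_def del: funpow.simps)
qed simp

lemma pullback_approx_tendsto:
  assumes "0 < a" and R: "bij_betw R B B" and \<psi>: "monotone_equiconcave B a \<psi>" and "\<theta> \<in> B"
  shows "decseq (\<lambda>n. pullback_approx B a R \<psi> n \<theta>)"
    and "(\<lambda>n. pullback_approx B a R \<psi> n \<theta>) \<longlonglongrightarrow> pullback_limit B a R \<psi> \<theta>"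
proof -
  have RB: "R ` B \<subseteq> B" using R by (simp add: bij_betw_def)
  have inv_B: "(inv_into B R ^^ n) \<theta> \<in> B" for n
    using \<open>\<theta> \<in> B\<close> R by (induction n) (auto simp: bij_betw_def inv_into_into)
  have a: "a \<in> {0..a}" using \<open>0 < a\<close> by simp
  have "pullback_approx B a R \<psi> (Suc n) \<theta> \<le> pullback_approx B a R \<psi> n \<theta>" for n
  proof -
    define w where "w = (inv_into B R ^^ n) \<theta>"
    define v where "v = inv_into B R w"
    have w: "w \<in> B" and v: "v \<in> B" using inv_B[of n] inv_B[of "Suc n"] by (simp_all add: w_def v_def)
    have Rv: "R v = w" using w R by (simp add: v_def bij_betw_def f_inv_into_f)
    have "\<psi> v a \<in> {0..a}" using \<psi> v a unfolding monotone_equiconcave_def by (blast dest: funcset_mem)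
    then have "snd ((skew_map R \<psi> ^^ n) (w, \<psi> v a)) \<le> snd ((skew_map R \<psi> ^^ n) (w, a))"
      using skew_map_iterate_mono[OF RB \<psi> w _ a] by simp
    moreover have "pullback_approx B a R \<psi> (Suc n) \<theta> = snd ((skew_map R \<psi> ^^ Suc n) (v, a))"
      by (simp add: pullback_approx_def v_def w_def)
    ultimately show ?thesis
      by (simp add: pullback_approx_def w_def[symmetric] funpow_Suc_right skew_map_def Rv
          del: funpow.simps)
  qed
  then show dec: "decseq (\<lambda>n. pullback_approx B a R \<psi> n \<theta>)"
    by (simp add: decseq_Suc_iff)
  have "0 \<le> pullback_approx B a R \<psi> n \<theta>" for n
    using skew_map_iterate_mono[OF RB \<psi> inv_B[of n] a a] by (simp add: pullback_approx_def)
  then have "convergent (\<lambda>n. pullback_approx B a R \<psi> n \<theta>)"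
    using decseq_convergent[OF dec, of 0] convergentI by metis
  then show "(\<lambda>n. pullback_approx B a R \<psi> n \<theta>) \<longlonglongrightarrow> pullback_limit B a R \<psi> \<theta>"
    unfolding pullback_limit_def by (simp add: convergent_LIMSEQ_iff)
qed

end

theory Submission
  imports Defs
begin

text \<open>Along two ordered orbits \<open>x\<^sub>n \<le> y\<^sub>n\<close> over the same base point, equiconcavity gives
  \<open>x\<^sub>n\<^sub>+\<^sub>1 / y\<^sub>n\<^sub>+\<^sub>1 \<ge> x\<^sub>n / y\<^sub>n (1 + \<beta> y\<^sub>n (y\<^sub>n - x\<^sub>n))\<close>: the ratio is nondecreasing, bounded by 1, and its
  increments dominate \<open>\<beta> (x\<^sub>0 / y\<^sub>0) (y\<^sub>n - x\<^sub>n)\<^sup>2\<close>, so \<open>y\<^sub>n - x\<^sub>n\<close> tends to 0. Since the graph of the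
  pullback limit is invariant, one of the two orbits may be taken on it. The argument is pointwise:
  every fiber over which the limit is positive lies in the basin, up to its zero.\<close>

lemma ratio_growth_imp_diff_tendsto_0:
  fixes X Y :: "nat \<Rightarrow> real"
  assumes "0 < c" "0 < X 0" and nonneg: "\<And>n. 0 \<le> X n" and le: "\<And>n. X n \<le> Y n"
    and zero: "\<And>n. Y n = 0 \<Longrightarrow> Y (Suc n) = 0"
    and growth: "\<And>n. X n * Y (Suc n) * (1 + c * Y n * (Y n - X n)) \<le> Y n * X (Suc n)"
  shows "(\<lambda>n. Y n - X n) \<longlonglongrightarrow> 0"
proof (cases "\<exists>N. Y N = 0")
  \<comment> \<open>Ratios are undefined here, but zero persists along the upper sequence by
    \<open>zero\<close>, and \<open>0 \<le> X n \<le> Y n\<close> squeezes the lower one to zero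
    with it.\<close>
  case True
  then obtain N where "Y N = 0" by blast
  have "Y n = 0" if "n \<ge> N" for n
    using that \<open>Y N = 0\<close> by (induction n rule: dec_induct) (auto intro: zero)
  then have "Y n - X n = 0" if "n \<ge> N" for n
    using that nonneg[of n] le[of n] by simp
  then show ?thesis
    by (intro tendsto_eventually eventually_sequentiallyI)
next
  case False
  define r where "r n = X n / Y n" for n
  have Y: "0 < Y n" for n
    using False nonneg[of n] le[of n] by (metis order.trans order_le_less)
  have X: "X n = r n * Y n" for n
    using Y[of n] by (simp add: r_def)
  have r: "0 \<le> r n" "r n \<le> 1" for n
    using Y[of n] nonneg[of n] le[of n] by (auto simp: r_def)
  have d: "0 \<le> Y n - X n" for n
    using le[of n] by simp
  \<comment> \<open>This is \<open>growth\<close> divided by \<open>Y n * Y (Suc n)\<close>, which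
    is positive in this case.\<close>
  have step: "r n * (1 + c * Y n * (Y n - X n)) \<le> r (Suc n)" for n
    using growth[of n] Y[of n] Y[of "Suc n"] by (simp add: r_def field_simps)
  have "r n \<le> r (Suc n)" for n
  proof -
    have "0 \<le> r n * (c * Y n * (Y n - X n))"
      using r(1)[of n] Y[of n] d[of n] \<open>0 < c\<close> by (intro mult_nonneg_nonneg) simp_all
    then show ?thesis using step[of n] by (simp add: distrib_left)
  qed
  then have inc: "incseq r" by (simp add: incseq_Suc_iff)
  have r0: "0 < r 0" using \<open>0 < X 0\<close> Y[of 0] by (simp add: r_def)
  have bound: "(Y n - X n)\<^sup>2 \<le> (r (Suc n) - r n) / (c * r 0)" for n
  proof -
    \<comment> \<open>Two weakenings at once: \<open>r 0 \<le> r n\<close> by monotonicity, and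
      \<open>Y n - X n \<le> Y n\<close> because \<open>X n\<close> is nonnegative. They leave a
      pure square with a coefficient independent of \<open>n\<close>.\<close>
    have "r 0 * (c * ((Y n - X n) * (Y n - X n))) \<le> r n * (c * (Y n * (Y n - X n)))"
      using incseqD[OF inc, of 0 n] r(1) d[of n] nonneg[of n] \<open>0 < c\<close>
      by (intro mult_mono mult_left_mono mult_right_mono mult_nonneg_nonneg) simp_all
    also have "\<dots> \<le> r (Suc n) - r n"
      using step[of n] by (simp add: algebra_simps)
    finally show ?thesis
      using \<open>0 < c\<close> r0 by (simp add: pos_le_divide_eq power2_eq_square mult.commute mult.left_commute)
  qed
  obtain L where L: "r \<longlonglongrightarrow> L"
    using incseq_convergent[OF inc, of 1] r(2) by blast
  \<comment> \<open>A bounded monotone sequence converges, so its increments vanish in the limit; by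
    \<open>bound\<close> the squares vanish too.\<close>
  have "(\<lambda>n. (r (Suc n) - r n) / (c * r 0)) \<longlonglongrightarrow> (L - L) / (c * r 0)"
    using \<open>0 < c\<close> r0 by (intro tendsto_divide tendsto_diff LIMSEQ_Suc[OF L] L tendsto_const) simp
  then have "(\<lambda>n. (r (Suc n) - r n) / (c * r 0)) \<longlonglongrightarrow> 0" by simp
  then have "(\<lambda>n. (Y n - X n)\<^sup>2) \<longlonglongrightarrow> 0"
    by (rule tendsto_sandwich[OF _ _ tendsto_const, rotated 2]) (use bound in auto)
  then show ?thesis by simp
qed

text \<open>The point \<open>x\<close> is the convex combination of 0 and \<open>y\<close> with
  weight \<open>x / y\<close>, so concavity and \<open>f 0 = 0\<close> yield y f(x) \<ge> x f(y) +
  \<alpha> x y (y - x). The form without division also covers vanishing \<open>y\<close> and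
  \<open>f y\<close>.\<close>

lemma alpha_concave_on_ratio_growth:
  assumes conc: "alpha_concave_on {0..a} (\<beta> * (SUP x\<in>{0..a}. f x)) f" and "0 \<le> \<beta>"
    and f: "f \<in> {0..a} \<rightarrow> {0..a}" "f 0 = 0" and xy: "0 \<le> x" "x \<le> y" "y \<le> a"
  shows "x * f y * (1 + \<beta> * y * (y - x)) \<le> y * f x"
proof (cases "y = 0")
  case False
  define \<alpha> where "\<alpha> = \<beta> * (SUP x\<in>{0..a}. f x)"
  have y: "0 < y" using False xy by simp
  have "bdd_above (f ` {0..a})"
    using f by (intro bdd_aboveI[of _ a]) auto
  then have "f y \<le> (SUP x\<in>{0..a}. f x)"
    using xy by (intro cSUP_upper) auto
  then have "\<beta> * f y \<le> \<alpha>"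
    using \<open>0 \<le> \<beta>\<close> by (simp add: \<alpha>_def mult_left_mono)
  \<comment> \<open>Since \<alpha> is proportional to the supremum of \<open>f\<close>, it dominates
    \<open>\<beta> * f y\<close>; thus \<open>f y\<close> factors out of the lower bound and the
    gain becomes multiplicative.\<close>
  then have "\<beta> * f y * (x * y * (y - x)) \<le> \<alpha> * (x * y * (y - x))"
    using xy by (intro mult_right_mono) auto
  moreover have "x / y * (f y + \<alpha> * y\<^sup>2) \<le> f x + \<alpha> * x\<^sup>2"
  proof -
    have "concave_on {0..a} (\<lambda>x. f x + \<alpha> * x\<^sup>2)"
      using conc by (simp add: alpha_concave_on_def \<alpha>_def)
    from concave_onD[OF this, of "x / y" 0 y] show ?thesis
      using xy y f(2) by simp
  qed
  then have "x * (f y + \<alpha> * y\<^sup>2) \<le> y * (f x + \<alpha> * x\<^sup>2)"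
    using y by (simp add: field_simps)
  ultimately show ?thesis
    by (simp add: algebra_simps power2_eq_square)
qed (use xy in simp)

lemma skew_map_apply: "skew_map R \<psi> p = (R (fst p), \<psi> (fst p) (snd p))"
  by (simp add: skew_map_def case_prod_beta)

lemma fst_skew_map_iterate: "fst ((skew_map R \<psi> ^^ n) (\<theta>, x)) = (R ^^ n) \<theta>"
  by (induction n) (simp_all add: skew_map_apply)

lemma snd_skew_map_iterate_Suc:
  "snd ((skew_map R \<psi> ^^ Suc n) (\<theta>, x)) = \<psi> ((R ^^ n) \<theta>) (snd ((skew_map R \<psi> ^^ n) (\<theta>, x)))"
  by (simp add: skew_map_apply fst_skew_map_iterate)

text \<open>The ratio estimate is applied at time \<open>n\<close> in the fiber over
  \<open>(R ^^ n) \<theta>\<close>. Equiconcavity supplies one \<beta> for all fibers, hence a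
  growth constant that does not depend on \<open>n\<close>. Positivity is asked only of the lower
  starting point: later values may vanish.\<close>

lemma skew_map_iterate_diff_tendsto_0:
  assumes R: "R ` B \<subseteq> B" and \<psi>: "monotone_equiconcave B a \<psi>" and "\<theta> \<in> B"
    and xy: "0 < x" "x \<le> y" "y \<le> a"
  shows "(\<lambda>n. snd ((skew_map R \<psi> ^^ n) (\<theta>, y)) - snd ((skew_map R \<psi> ^^ n) (\<theta>, x))) \<longlonglongrightarrow> 0"
proof -
  define X where "X n = snd ((skew_map R \<psi> ^^ n) (\<theta>, x))" for n
  define Y where "Y n = snd ((skew_map R \<psi> ^^ n) (\<theta>, y))" for n
  obtain \<beta> where \<beta>: "0 < \<beta>"
    "\<And>\<theta>. \<theta> \<in> B \<Longrightarrow> alpha_concave_on {0..a} (\<beta> * (SUP x\<in>{0..a}. \<psi> \<theta> x)) (\<psi> \<theta>)"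
    using \<psi> unfolding monotone_equiconcave_def by blast
  have \<psi>_B: "\<psi> \<theta> \<in> {0..a} \<rightarrow> {0..a}" "\<psi> \<theta> 0 = 0" if "\<theta> \<in> B" for \<theta>
    using \<psi> that unfolding monotone_equiconcave_def by blast+
  have B: "(R ^^ n) \<theta> \<in> B" for n
    using \<open>\<theta> \<in> B\<close> R by (induction n) auto
  have Suc: "X (Suc n) = \<psi> ((R ^^ n) \<theta>) (X n)" "Y (Suc n) = \<psi> ((R ^^ n) \<theta>) (Y n)" for n
    unfolding X_def Y_def by (rule snd_skew_map_iterate_Suc)+
  have XY: "0 \<le> X n" "X n \<le> Y n" "Y n \<le> a" for n
    using skew_map_iterate_mono[OF R \<psi> \<open>\<theta> \<in> B\<close>, of x y n] xy by (auto simp: X_def Y_def)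
  have "(\<lambda>n. Y n - X n) \<longlonglongrightarrow> 0"
  proof (rule ratio_growth_imp_diff_tendsto_0[OF \<open>0 < \<beta>\<close>])
    show "0 < X 0" using xy by (simp add: X_def)
    show "Y (Suc n) = 0" if "Y n = 0" for n
      using that \<psi>_B(2)[OF B] by (simp add: Suc)
    show "X n * Y (Suc n) * (1 + \<beta> * Y n * (Y n - X n)) \<le> Y n * X (Suc n)" for n
      unfolding Suc using \<beta> \<psi>_B B XY by (intro alpha_concave_on_ratio_growth) auto
  qed (use XY in auto)
  then show ?thesis by (simp add: X_def Y_def)
qed

lemma pullback_limit_in_fiber:
  assumes "0 < a" and R: "bij_betw R B B" and \<psi>: "monotone_equiconcave B a \<psi>" and "\<theta> \<in> B"
  shows "pullback_approx B a R \<psi> n \<theta> \<in> {0..a}" and "pullback_limit B a R \<psi> \<theta> \<in> {0..a}"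
proof -
  have RB: "R ` B \<subseteq> B" using R by (simp add: bij_betw_def)
  have "(inv_into B R ^^ n) \<theta> \<in> B" for n
    using \<open>\<theta> \<in> B\<close> R by (induction n) (auto simp: bij_betw_def inv_into_into)
  then have approx: "pullback_approx B a R \<psi> n \<theta> \<in> {0..a}" for n
    using skew_map_iterate_mono[OF RB \<psi>, of _ a a n] \<open>0 < a\<close> by (simp add: pullback_approx_def)
  then show "pullback_approx B a R \<psi> n \<theta> \<in> {0..a}" .
  show "pullback_limit B a R \<psi> \<theta> \<in> {0..a}"
    using closed_sequentially[OF closed_atLeastAtMost approx pullback_approx_tendsto(2)[OF assms]] .
qed

text \<open>The pullback of length \<open>Suc n\<close> ending over \<open>R \<theta>\<close> starts
  at the same base point as the one of length \<open>n\<close> ending over \<theta>, and differs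
  from it by one last application of \<open>\<psi> \<theta>\<close>. Continuity of
  \<open>\<psi> \<theta>\<close> carries this to the limit.\<close>

lemma pullback_limit_invariant:
  assumes "0 < a" and R: "bij_betw R B B" and \<psi>: "monotone_equiconcave B a \<psi>" and "\<theta> \<in> B"
  shows "pullback_limit B a R \<psi> (R \<theta>) = \<psi> \<theta> (pullback_limit B a R \<psi> \<theta>)"
proof -
  have "R \<theta> \<in> B" using R \<open>\<theta> \<in> B\<close> by (auto simp: bij_betw_def)
  \<comment> \<open>\<open>inv_into\<close> inverts \<open>R\<close> only on \<open>B\<close>, so
    the induction carries membership in \<open>B\<close> together with the cancellation.\<close>
  have R_inv: "(R ^^ n) ((inv_into B R ^^ n) \<theta>) = \<theta> \<and> (inv_into B R ^^ n) \<theta> \<in> B" for n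
  proof (induction n)
    case (Suc n)
    define w where "w = (inv_into B R ^^ n) \<theta>"
    have "R (inv_into B R w) = w" "inv_into B R w \<in> B"
      using Suc R by (simp_all add: w_def bij_betw_def f_inv_into_f inv_into_into)
    then have "(R ^^ Suc n) (inv_into B R w) = \<theta>"
      using Suc by (simp add: funpow_Suc_right w_def del: funpow.simps(2))
    then show ?case
      using \<open>inv_into B R w \<in> B\<close> by (simp add: w_def)
  qed (use \<open>\<theta> \<in> B\<close> in simp)
  have "pullback_approx B a R \<psi> (Suc n) (R \<theta>) = \<psi> \<theta> (pullback_approx B a R \<psi> n \<theta>)" for n
  proof -
    have "(inv_into B R ^^ Suc n) (R \<theta>) = (inv_into B R ^^ n) \<theta>"
      using R \<open>\<theta> \<in> B\<close> by (simp add: funpow_Suc_right bij_betw_def del: funpow.simps(2))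
    then show ?thesis
      using R_inv[of n] by (simp add: pullback_approx_def snd_skew_map_iterate_Suc del: funpow.simps(2))
  qed
  moreover have "(\<lambda>n. \<psi> \<theta> (pullback_approx B a R \<psi> n \<theta>)) \<longlonglongrightarrow> \<psi> \<theta> (pullback_limit B a R \<psi> \<theta>)"
  proof -
    have "continuous_on {0..a} (\<psi> \<theta>)"
      using \<psi> \<open>\<theta> \<in> B\<close> by (auto simp: monotone_equiconcave_def alpha_concave_on_def)
    from continuous_on_tendsto_compose[OF this pullback_approx_tendsto(2)[OF assms]]
    show ?thesis
      using pullback_limit_in_fiber[OF assms] by simp
  qed
  moreover have "(\<lambda>n. pullback_approx B a R \<psi> (Suc n) (R \<theta>)) \<longlonglongrightarrow> pullback_limit B a R \<psi> (R \<theta>)"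
    using pullback_approx_tendsto(2)[OF assms(1-3) \<open>R \<theta> \<in> B\<close>] by (rule LIMSEQ_Suc)
  ultimately show ?thesis
    using LIMSEQ_unique by auto
qed

text \<open>This replaces the target \<phi>(R^n \<theta>) in the definition of the basin by an
  orbit, so that attraction to the graph becomes a comparison of two orbits.\<close>

lemma pullback_limit_graph_orbit:
  assumes "0 < a" and R: "bij_betw R B B" and \<psi>: "monotone_equiconcave B a \<psi>" and "\<theta> \<in> B"
  shows "snd ((skew_map R \<psi> ^^ n) (\<theta>, pullback_limit B a R \<psi> \<theta>)) = pullback_limit B a R \<psi> ((R ^^ n) \<theta>)"
proof (induction n)
  case (Suc n)
  have "(R ^^ n) \<theta> \<in> B"
    using R \<open>\<theta> \<in> B\<close> by (induction n) (auto simp: bij_betw_def)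
  then show ?case
    unfolding snd_skew_map_iterate_Suc Suc by (simp add: pullback_limit_invariant[OF assms(1-3)])
qed simp

lemma graph_basin_pullback_limit:
  assumes "0 < a" and R: "bij_betw R B B" and \<psi>: "monotone_equiconcave B a \<psi>" and "\<theta> \<in> B"
    and pos: "0 < pullback_limit B a R \<psi> \<theta>"
  shows "{\<theta>} \<times> {0<..a} \<subseteq> graph_basin B a R \<psi> (pullback_limit B a R \<psi>)"
proof -
  define \<phi> where "\<phi> = pullback_limit B a R \<psi>"
  have RB: "R ` B \<subseteq> B" using R by (simp add: bij_betw_def)
  have "\<phi> \<theta> \<le> a"
    using pullback_limit_in_fiber(2)[OF assms(1-4)] by (simp add: \<phi>_def)
  have "(\<lambda>n. \<bar>snd ((skew_map R \<psi> ^^ n) (\<theta>, x)) - snd ((skew_map R \<psi> ^^ n) (\<theta>, \<phi> \<theta>))\<bar>) \<longlonglongrightarrow> 0"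
    if x: "0 < x" "x \<le> a" for x
  proof (cases "x \<le> \<phi> \<theta>")
    case True
    from skew_map_iterate_diff_tendsto_0[OF RB \<psi> \<open>\<theta> \<in> B\<close> x(1) True \<open>\<phi> \<theta> \<le> a\<close>]
    show ?thesis by (subst abs_minus_commute) (rule tendsto_rabs_zero)
  next
    \<comment> \<open>Now the graph is the lower orbit, and \<open>pos\<close> provides the positive
      start that \<open>x\<close> itself provided in the other case.\<close>
    case False
    then have "\<phi> \<theta> \<le> x" by simp
    from skew_map_iterate_diff_tendsto_0[OF RB \<psi> \<open>\<theta> \<in> B\<close> _ this x(2)] pos
    show ?thesis by (simp add: \<phi>_def tendsto_rabs_zero)
  qed
  then show ?thesis
    using pullback_limit_graph_orbit[OF assms(1-4)] \<open>\<theta> \<in> B\<close> by (auto simp: graph_basin_def \<phi>_def)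
qed

theorem theorem6p8:
  fixes a :: real and M :: "'b measure" and R :: "'b \<Rightarrow> 'b" and \<psi> :: "'b \<Rightarrow> real \<Rightarrow> real"
  assumes "0 < a"
    and "prob_space M"
    and "bij_betw R (space M) (space M)"
    and "measure_preserving_map M R"
    and "ergodic_measure M R"
    and "monotone_equiconcave (space M) a \<psi>"
    and "AE \<theta> in M. 0 < pullback_limit (space M) a R \<psi> \<theta>"
  shows "graph_attractor M a R \<psi> (pullback_limit (space M) a R \<psi>) \<and>
    (\<exists>Z\<in>sets M. measure M Z = 1 \<and>
       Z \<times> {0<..a} \<subseteq> graph_basin (space M) a R \<psi> (pullback_limit (space M) a R \<psi>))"
proof -
  interpret prob_space M by fact
  let ?\<phi> = "pullback_limit (space M) a R \<psi>"
  note sys = assms(1,3,6)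
  have basin: "{\<theta>} \<times> {0<..a} \<subseteq> graph_basin (space M) a R \<psi> ?\<phi>"
    if "\<theta> \<in> space M" "0 < ?\<phi> \<theta>" for \<theta>
    using graph_basin_pullback_limit[OF sys that] .
  have range: "?\<phi> \<theta> \<in> {0..a}" if "\<theta> \<in> space M" for \<theta>
    using pullback_limit_in_fiber(2)[OF sys that] .
  \<comment> \<open>The half-open interval is relatively open in the fiber and serves as the
    neighborhood \<open>U\<close> over every base point where the limit is positive.\<close>
  have "{0<..a} = {0..a} \<inter> {0<..}" by auto
  then have nhd: "openin (top_of_set {0..a}) {0<..a}"
    by (metis openin_open open_greaterThan)
  have "AE \<theta> in M. (\<theta>, ?\<phi> \<theta>) \<in> graph_basin (space M) a R \<psi> ?\<phi> \<and>
      (\<exists>U. openin (top_of_set {0..a}) U \<and> ?\<phi> \<theta> \<in> U \<and> {\<theta>} \<times> U \<subseteq> graph_basin (space M) a R \<psi> ?\<phi>)"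
    using assms(7) AE_space
  proof eventually_elim
    case (elim \<theta>)
    have "?\<phi> \<theta> \<in> {0<..a}" using elim range[of \<theta>] by simp
    then show ?case using basin[of \<theta>] elim nhd by blast
  qed
  then have "graph_attractor M a R \<psi> ?\<phi>"
    using range by (auto simp: graph_attractor_def)
  \<comment> \<open>\<open>Z\<close> must be measurable, so it is taken as the complement of a
    measurable null set covering the points where the limit is not positive.\<close>
  moreover obtain N where N: "{\<theta> \<in> space M. \<not> 0 < ?\<phi> \<theta>} \<subseteq> N" "emeasure M N = 0" "N \<in> sets M"
    using assms(7) by (rule AE_E)
  then have "prob N = 0" by (simp add: measure_def)
  then have "prob (space M - N) = 1"
    using N(3) by (simp add: prob_compl)
  moreover have "(space M - N) \<times> {0<..a} \<subseteq> graph_basin (space M) a R \<psi> ?\<phi>"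
    using basin N(1) by blast
  ultimately show ?thesis
    using N(3) by (intro conjI bexI[of _ "space M - N"]) auto
qed

end
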